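(* Let $G$ be a Hausdorff strongly topological gyrogroup. If $G$ is first-countable and left $\omega$-narrow, then $G$ is separable (that is, $G$ has a countable dense subset).
   Context: All topological spaces are assumed to be Hausdorff. A gyrogroup is a set $G$ with a binary operation $\oplus$ such that: (G1) there is a unique $0\in G$ with $0\oplus a=a=a\oplus 0$ for all $a\in G$; (G2) each $x\in G$ has a unique inverse $\ominus x\in G$ with $\ominus x\oplus x=0=x\oplus(\ominus x)$; (G3) for all $x,y\in G$ there is $\mathrm{gyr}[x,y]\in\mathrm{Aut}(G,\oplus)$ (a bijection of $G$ preserving $\oplus$) with $x\oplus(y\oplus z)=(x\oplus y)\oplus\mathrm{gyr}[x,y](z)$ for all $z\in G$; (G4) $\mathrm{gyr}[x\oplus y,y]=\mathrm{gyr}[x,y]$ for all $x,y\in G$. A topological gyrogroup is a gyrogroup $G$ with a topology such that $\oplus:G\times G\to G$ is jointly continuous and $x\mapsto\ominus x$ is continuous. A strongly topological gyrogroup is a topological gyrogroup having a neighborhood base $\mathscr U$ of $0$ such that $\mathrm{gyr}[x,y](U)=U$ for all $U\in\mathscr U$ and all $x,y\in G$. For $A,B\subset G$, $A\oplus B=\{a\oplus b:a\in A,b\in B\}$. A topological gyrogroup $G$ is left $\omega$-narrow if for every open neighborhood $V$ of $0$ there is a countable $A\subset G$ with $G=A\oplus V$. *)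

theory Defs
  imports "HOL-Analysis.Analysis"
begin

text \<open>
  The identity \<open>zero\<close>, the inversion \<open>\<ominus>\<close> and the gyrations \<open>gyr\<close> are parameters of the locale.
  The axioms determine their values on the carrier \<open>G\<close>; values at arguments outside \<open>G\<close> are
  unconstrained.
\<close>

locale gyrogroup =
  fixes G :: "'a set"
    and gyroadd :: "'a \<Rightarrow> 'a \<Rightarrow> 'a"  (infixl "\<oplus>" 65)
    and zero :: 'a
    and gyroneg :: "'a \<Rightarrow> 'a"  ("\<ominus> _" [81] 80)
    and gyr :: "'a \<Rightarrow> 'a \<Rightarrow> 'a \<Rightarrow> 'a"
  assumes add_closed: "\<lbrakk>x \<in> G; y \<in> G\<rbrakk> \<Longrightarrow> x \<oplus> y \<in> G"
    and zero_closed: "zero \<in> G"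
    and zero_identity: "a \<in> G \<Longrightarrow> zero \<oplus> a = a \<and> a \<oplus> zero = a"
    and zero_unique: "\<lbrakk>e \<in> G; \<And>a. a \<in> G \<Longrightarrow> e \<oplus> a = a \<and> a \<oplus> e = a\<rbrakk> \<Longrightarrow> e = zero"
    and neg_closed: "x \<in> G \<Longrightarrow> \<ominus> x \<in> G"
    and neg_inverse: "x \<in> G \<Longrightarrow> \<ominus> x \<oplus> x = zero \<and> x \<oplus> \<ominus> x = zero"
    and neg_unique: "\<lbrakk>x \<in> G; y \<in> G; y \<oplus> x = zero; x \<oplus> y = zero\<rbrakk> \<Longrightarrow> y = \<ominus> x"
    and gyr_bij: "\<lbrakk>x \<in> G; y \<in> G\<rbrakk> \<Longrightarrow> bij_betw (gyr x y) G G"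
    and gyr_hom: "\<lbrakk>x \<in> G; y \<in> G; u \<in> G; v \<in> G\<rbrakk> \<Longrightarrow> gyr x y (u \<oplus> v) = gyr x y u \<oplus> gyr x y v"
    and left_gyroassoc: "\<lbrakk>x \<in> G; y \<in> G; z \<in> G\<rbrakk> \<Longrightarrow> x \<oplus> (y \<oplus> z) = (x \<oplus> y) \<oplus> gyr x y z"
    and left_loop: "\<lbrakk>x \<in> G; y \<in> G; z \<in> G\<rbrakk> \<Longrightarrow> gyr (x \<oplus> y) y z = gyr x y z"

locale topological_gyrogroup = gyrogroup +
  fixes T :: "'a topology"
  assumes topspace_eq: "topspace T = G"
    and continuous_add: "continuous_map (prod_topology T T) T (\<lambda>(x, y). x \<oplus> y)"
    and continuous_neg: "continuous_map T T (\<lambda>x. \<ominus> x)"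

text \<open>
  Members of the neighbourhood base are not required to be open.  The predicate
  \<^const>\<open>neighbourhood_base_at\<close> does not say that they are neighbourhoods of \<open>zero\<close>, so this is
  stated separately.
\<close>

locale strongly_topological_gyrogroup = topological_gyrogroup +
  assumes gyr_invariant_base:
    "\<exists>\<U>. (\<forall>U\<in>\<U>. U \<subseteq> G \<and> zero \<in> T interior_of U) \<and>
          neighbourhood_base_at zero (\<lambda>U. U \<in> \<U>) T \<and>
          (\<forall>U\<in>\<U>. \<forall>x\<in>G. \<forall>y\<in>G. gyr x y ` U = U)"

definition set_gyroadd :: "('a \<Rightarrow> 'a \<Rightarrow> 'a) \<Rightarrow> 'a set \<Rightarrow> 'a set \<Rightarrow> 'a set" where
  "set_gyroadd add A B = {add a b |a b. a \<in> A \<and> b \<in> B}"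

definition left_omega_narrow ::
  "'a set \<Rightarrow> ('a \<Rightarrow> 'a \<Rightarrow> 'a) \<Rightarrow> 'a \<Rightarrow> 'a topology \<Rightarrow> bool" where
  "left_omega_narrow G add zero T \<longleftrightarrow>
     (\<forall>V. openin T V \<and> zero \<in> V \<longrightarrow>
        (\<exists>A. countable A \<and> A \<subseteq> G \<and> G = set_gyroadd add A V))"

end

theory Submission
  imports Defs
begin

text \<open>
  Let \<open>\<B>\<close> be a countable base at \<open>zero\<close>. For each \<open>V \<in> \<B>\<close> containing \<open>zero\<close> take a countable
  \<open>A V\<close> with \<open>G = A V \<oplus> V\<close>; the union of the sets \<open>A V\<close> is dense. Indeed, if \<open>x = a \<oplus> v\<close> then
  \<open>a = x \<oplus> gyr a v (\<ominus> v)\<close>, and gyrations cannot move \<open>\<ominus> v\<close> out of a gyration-invariant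
  neighbourhood, so \<open>a\<close> is close to \<open>x\<close> as soon as \<open>v\<close> is close to \<open>zero\<close>.
\<close>

text \<open>Left gyroassociativity at \<open>a\<close>, \<open>v\<close>,
  \<open>\<ominus> v\<close>, where \<open>a \<oplus> (v \<oplus> \<ominus> v)\<close> collapses to
  \<open>a\<close>.\<close>

lemma (in gyrogroup) add_gyr_neg_cancel:
  assumes "a \<in> G" "v \<in> G"
  shows "(a \<oplus> v) \<oplus> gyr a v (\<ominus> v) = a"
  using assms left_gyroassoc[of a v "\<ominus> v"] neg_closed neg_inverse zero_identity by simp

lemma (in gyrogroup) neg_zero: "\<ominus> zero = zero"
  using neg_unique[of zero zero] zero_closed zero_identity by simp

lemma (in topological_gyrogroup) openin_left_translate_vimage:
  assumes "x \<in> G" "openin T W"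
  shows "openin T {z \<in> G. x \<oplus> z \<in> W}"
proof -
  have "continuous_map T (prod_topology T T) (\<lambda>z. (x, z))"
    using assms(1) topspace_eq by (simp add: continuous_map_pairwise o_def)
  from continuous_map_compose[OF this continuous_add]
  have "continuous_map T T (\<lambda>z. x \<oplus> z)"
    by (simp add: o_def)
  from openin_continuous_map_preimage[OF this assms(2)] show ?thesis
    by (simp add: topspace_eq)
qed

text \<open>The point is that \<open>V\<close> depends on \<open>x\<close> and \<open>W\<close>
  only: the gyration \<open>gyr a v\<close> varies with \<open>a\<close>, but every gyration maps
  the chosen \<open>U\<close> onto itself.\<close>

lemma (in strongly_topological_gyrogroup) right_translate_uniform:
  assumes "x \<in> G" "openin T W" "x \<in> W"
  obtains V where "openin T V" "zero \<in> V"
    "\<And>a v. a \<in> G \<Longrightarrow> v \<in> V \<Longrightarrow> a \<oplus> v = x \<Longrightarrow> a \<in> W"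
proof -
  define N where "N = {z \<in> G. x \<oplus> z \<in> W}"
  have "openin T N" "zero \<in> N"
    using assms openin_left_translate_vimage zero_closed zero_identity by (auto simp: N_def)
  then obtain U where U: "U \<subseteq> N" "zero \<in> T interior_of U"
    and inv: "\<And>a b. a \<in> G \<Longrightarrow> b \<in> G \<Longrightarrow> gyr a b ` U = U"
    using gyr_invariant_base unfolding neighbourhood_base_at_def by meson
  \<comment> \<open>\<open>U\<close> may fail to be open, so its interior is pulled back along
    inversion to make \<open>V\<close> open.\<close>
  define V where "V = {v \<in> G. \<ominus> v \<in> T interior_of U}"
  show thesis
  proof
    show "openin T V"
      using openin_continuous_map_preimage[OF continuous_neg openin_interior_of]
      by (simp add: V_def topspace_eq)
    show "zero \<in> V"
      using U(2) by (simp add: V_def neg_zero zero_closed)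
    fix a v
    assume a: "a \<in> G" and v: "v \<in> V" and x: "a \<oplus> v = x"
    have "v \<in> G" "\<ominus> v \<in> U"
      using v interior_of_subset[of T U] by (auto simp: V_def)
    then have "gyr a v (\<ominus> v) \<in> N"
      using inv[OF a] U(1) by blast
    then show "a \<in> W"
      using add_gyr_neg_cancel[OF a \<open>v \<in> G\<close>] x by (simp add: N_def)
  qed
qed

theorem corollary3p14:
  fixes G :: "'a set"
    and add :: "'a \<Rightarrow> 'a \<Rightarrow> 'a"
    and zero :: 'a
    and neg :: "'a \<Rightarrow> 'a"
    and gyr :: "'a \<Rightarrow> 'a \<Rightarrow> 'a \<Rightarrow> 'a"
    and T :: "'a topology"
  assumes "strongly_topological_gyrogroup G add zero neg gyr T"
    and "Hausdorff_space T"
    and "first_countable T"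
    and "left_omega_narrow G add zero T"
  shows "separable_space T"
proof -
  interpret strongly_topological_gyrogroup G add zero neg gyr T
    by (fact assms(1))
  obtain \<B> where "countable \<B>" and op: "\<And>V. V \<in> \<B> \<Longrightarrow> openin T V"
    and base: "\<And>U. openin T U \<Longrightarrow> zero \<in> U \<Longrightarrow> \<exists>V\<in>\<B>. zero \<in> V \<and> V \<subseteq> U"
    using assms(3) zero_closed topspace_eq unfolding first_countable_def by metis
  \<comment> \<open>Members of \<open>\<B>\<close> may miss \<open>zero\<close>, while narrowness
    speaks only of neighbourhoods of \<open>zero\<close>; hence the restriction.\<close>
  have "\<forall>V\<in>{V\<in>\<B>. zero \<in> V}. \<exists>A. countable A \<and> A \<subseteq> G \<and> G = set_gyroadd add A V"
    using assms(4) op by (auto simp: left_omega_narrow_def)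
  then obtain A where A: "\<And>V. V \<in> \<B> \<Longrightarrow> zero \<in> V \<Longrightarrow>
      countable (A V) \<and> A V \<subseteq> G \<and> G = set_gyroadd add (A V) V"
    by (metis (mono_tags, lifting) mem_Collect_eq)
  define D where "D = (\<Union>V\<in>{V\<in>\<B>. zero \<in> V}. A V)"
  have "countable D"
    using \<open>countable \<B>\<close> A by (auto simp: D_def)
  moreover have "D \<subseteq> topspace T"
    using A by (auto simp: D_def topspace_eq)
  moreover have "x \<in> T closure_of D" if x: "x \<in> G" for x
    unfolding in_closure_of
  proof (intro conjI allI impI)
    show "x \<in> topspace T"
      using x by (simp add: topspace_eq)
    fix W
    assume "x \<in> W \<and> openin T W"
    \<comment> \<open>\<open>U\<close> is fixed before \<open>a\<close> is known, so a basic
      \<open>V\<close> inside it can be chosen first; splitting \<open>x\<close> along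
      \<open>A V\<close> and \<open>V\<close> then yields \<open>a\<close>.\<close>
    then obtain U where "openin T U" "zero \<in> U"
      and U: "\<And>a v. a \<in> G \<Longrightarrow> v \<in> U \<Longrightarrow> add a v = x \<Longrightarrow> a \<in> W"
      using right_translate_uniform[OF x] by metis
    then obtain V where V: "V \<in> \<B>" "zero \<in> V" "V \<subseteq> U"
      using base by blast
    then obtain a v where av: "a \<in> A V" "v \<in> V" "add a v = x"
      using A x unfolding set_gyroadd_def by blast
    have "a \<in> D"
      using V av by (auto simp: D_def)
    moreover have "a \<in> W"
      using U[of a v] A[OF V(1,2)] V(3) av by blast
    ultimately show "\<exists>y. y \<in> D \<and> y \<in> W"
      by blast
  qed
  ultimately show ?thesis
    unfolding separable_space_def
    using closure_of_subset_topspace[of T D] topspace_eq by blast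
qed

end
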